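(* Suppose that $m \geq 2$ is an integer and $n \in \{m,m+1\}$. Then $r(B(m,n)) \leq 2m+n+2$.
   Context: All graphs are finite, simple and undirected. For a graph $G$, the Ramsey number $r(G)$ is the minimum $r$ such that any $2$-coloring of the edges of the complete graph $K_r$ yields a monochromatic subgraph (not necessarily induced) isomorphic to $G$. The bistar $B(m,n)$ is the tree with exactly two non-leaf vertices (called centers), which are adjacent to each other, one of them having exactly $m$ leaf neighbors (so degree $m+1$) and the other having exactly $n$ leaf neighbors (so degree $n+1$). *)

theory Defs
  imports "HOL-Library.Ramsey"
begin

text \<open>A graph is a pair of a vertex set \<open>V\<close> and a set \<open>E\<close> of two-element
  subsets of \<open>V\<close>; the set \<open>[V]\<^bsup>2\<^esup>\<close> from \<open>HOL-Library.Ramsey\<close> is the edge set of the complete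
  graph on \<open>V\<close>.\<close>

type_synonym 'a graph = "'a set \<times> 'a set set"

abbreviation verts :: "'a graph \<Rightarrow> 'a set" where "verts G \<equiv> fst G"
abbreviation edges :: "'a graph \<Rightarrow> 'a set set" where "edges G \<equiv> snd G"

definition fin_simple_graph :: "'a graph \<Rightarrow> bool" where
  "fin_simple_graph G \<longleftrightarrow> finite (verts G) \<and> edges G \<subseteq> [verts G]\<^bsup>2\<^esup>"

definition complete_graph :: "nat \<Rightarrow> nat graph" where
  "complete_graph r = ({..<r}, [{..<r}]\<^bsup>2\<^esup>)"

definition subgraph :: "'a graph \<Rightarrow> 'a graph \<Rightarrow> bool" where
  "subgraph H G \<longleftrightarrow> fin_simple_graph H \<and> verts H \<subseteq> verts G \<and> edges H \<subseteq> edges G"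

definition graph_isomorphic :: "'a graph \<Rightarrow> 'b graph \<Rightarrow> bool" where
  "graph_isomorphic G H \<longleftrightarrow>
     (\<exists>f. bij_betw f (verts G) (verts H) \<and>
          (\<forall>u\<in>verts G. \<forall>v\<in>verts G. {u, v} \<in> edges G \<longleftrightarrow> {f u, f v} \<in> edges H))"

definition two_colorings :: "'a graph \<Rightarrow> ('a set \<Rightarrow> nat) set" where
  "two_colorings G = edges G \<rightarrow> {0, 1}"

definition mono_edges :: "('a set \<Rightarrow> nat) \<Rightarrow> 'a graph \<Rightarrow> bool" where
  "mono_edges \<chi> H \<longleftrightarrow> (\<exists>c. \<forall>e\<in>edges H. \<chi> e = c)"

text \<open>For finite graphs the minimum below exists by Ramsey's theorem, so \<open>LEAST\<close> is never
  applied to an unsatisfiable predicate.\<close>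

definition ramsey_number :: "'a graph \<Rightarrow> nat" where
  "ramsey_number G =
     (LEAST r. \<forall>\<chi>\<in>two_colorings (complete_graph r).
        \<exists>H. subgraph H (complete_graph r) \<and> mono_edges \<chi> H \<and> graph_isomorphic G H)"

definition neighbors :: "'a graph \<Rightarrow> 'a \<Rightarrow> 'a set" where
  "neighbors G v = {u \<in> verts G. {u, v} \<in> edges G}"

definition degree :: "'a graph \<Rightarrow> 'a \<Rightarrow> nat" where
  "degree G v = card (neighbors G v)"

definition leaf :: "'a graph \<Rightarrow> 'a \<Rightarrow> bool" where
  "leaf G v \<longleftrightarrow> v \<in> verts G \<and> degree G v = 1"

definition connected_graph :: "'a graph \<Rightarrow> bool" where
  "connected_graph G \<longleftrightarrow> verts G \<noteq> {} \<and>
     (\<forall>u\<in>verts G. \<forall>v\<in>verts G. (u, v) \<in> {(x, y). {x, y} \<in> edges G}\<^sup>*)"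

definition cycle :: "'a graph \<Rightarrow> 'a list \<Rightarrow> bool" where
  "cycle G p \<longleftrightarrow> 3 \<le> length p \<and> distinct p \<and> set p \<subseteq> verts G \<and>
     (\<forall>i < length p. {p ! i, p ! (Suc i mod length p)} \<in> edges G)"

definition tree :: "'a graph \<Rightarrow> bool" where
  "tree G \<longleftrightarrow> fin_simple_graph G \<and> connected_graph G \<and> (\<nexists>p. cycle G p)"

text \<open>\<open>B(m,n)\<close> is determined only up to isomorphism, so it is rendered as a predicate on graphs.
  The ordered choice of the centers \<open>a\<close>, \<open>b\<close> is existential, so the predicate is symmetric in
  \<open>m\<close> and \<open>n\<close>.\<close>

definition bistar :: "nat \<Rightarrow> nat \<Rightarrow> 'a graph \<Rightarrow> bool" where
  "bistar m n G \<longleftrightarrow> tree G \<and>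
     (\<exists>a b. a \<noteq> b \<and> {v \<in> verts G. \<not> leaf G v} = {a, b} \<and> {a, b} \<in> edges G \<and>
        card {v \<in> neighbors G a. leaf G v} = m \<and>
        card {v \<in> neighbors G b. leaf G v} = n)"

end

theory Submission
  imports Defs
begin

text \<open>
  Write \<open>N = 2m + n + 2\<close>. A colour \<open>c\<close> contains a copy of \<open>B(m,n)\<close> as soon as some edge
  \<open>uv\<close> of colour \<open>c\<close> has enough other \<open>c\<close>-neighbours at both ends, and enough of them in total
  to be shared out between the two centres. So if no copy exists, the \<open>c\<close>-neighbourhoods of the
  ends of a \<open>c\<close>-edge cover few vertices, and what they leave over is joined to both ends
  in the other colour: provided both ends have \<open>c\<close>-degree at least \<open>m + 1\<close>, there are at least
  \<open>m + 1\<close> such vertices (\<open>common_nbrs_of_edge\<close>).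

  The same fact removes the degree condition (\<open>min_degree\<close>). If \<open>x\<close> had \<open>c\<close>-degree at most \<open>m\<close>,
  every neighbour of \<open>x\<close> in the other colour \<open>d\<close> would have \<open>d\<close>-degree at most \<open>m\<close>, since
  the ends of an edge of large \<open>d\<close>-degrees have \<open>m + 1\<close> common \<open>c\<close>-neighbours. Symmetrically, a
  \<open>c\<close>-edge between two of these neighbours would force \<open>m + 1\<close> common \<open>d\<close>-neighbours, so the
  neighbours form a \<open>d\<close>-clique. There are more than \<open>m\<close> of them, and the \<open>d\<close>-degrees in the
  clique are too large.

  Hence every edge \<open>uv\<close> lies in at least \<open>m + 1\<close> triangles \<open>uvw\<close> whose other two edges have the
  opposite colour. In a triangle at most one edge has a colour different from both others, so
  averaging over all triangles gives \<open>3 (m + 1) \<le> N - 2 = 2m + n\<close> (\<open>opp_nbrs_count\<close>), which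
  fails because \<open>n \<le> m + 1\<close>.

  What remains is to see that a bistar consists of two adjacent centres and two disjoint
  sets of leaves with no further edges (\<open>bistar_structure\<close>), so that it maps
  injectively into any such configuration.
\<close>

section \<open>Monochromatic double stars in a two-coloured complete graph\<close>

text \<open>A two-set version of Hall's theorem. Elements of \<open>Y - X\<close> are of no use to \<open>A\<close>, so \<open>B\<close> is
  built from them first and draws on \<open>X \<inter> Y\<close> only when they run out; the bound on the union says
  that enough of \<open>X\<close> then survives.\<close>

lemma disjoint_subsets_of_cards:
  assumes fin: "finite X" "finite Y"
    and "m \<le> card X" "n \<le> card Y" "m + n \<le> card (X \<union> Y)"
  shows "\<exists>A B. A \<subseteq> X \<and> B \<subseteq> Y \<and> A \<inter> B = {} \<and> card A = m \<and> card B = n"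
proof (cases "n \<le> card (Y - X)")
  case True
  obtain A where "A \<subseteq> X" "card A = m"
    using assms(3) obtain_subset_with_card_n by metis
  moreover obtain B where "B \<subseteq> Y - X" "card B = n"
    using True obtain_subset_with_card_n by metis
  ultimately show ?thesis by blast
next
  case False
  have cY: "card Y = card (Y - X) + card (X \<inter> Y)"
    using fin card_Int_Diff[of Y X] by (simp add: Int_commute)
  have cU: "card (X \<union> Y) = card X + card (Y - X)"
    using fin card_Un_disjoint[of X "Y - X"] by simp
  obtain B' where B': "B' \<subseteq> X \<inter> Y" "card B' = n - card (Y - X)"
    using cY assms(4) obtain_subset_with_card_n[of "n - card (Y - X)" "X \<inter> Y"]
    by (metis add.commute le_diff_conv)
  have finB': "finite B'" using B'(1) fin by (meson finite_Int finite_subset)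
  have "card (X - B') = card X - card B'"
    using B'(1) finB' by (intro card_Diff_subset) auto
  then have "m \<le> card (X - B')" using B'(2) cU assms(5) False by linarith
  then obtain A where A: "A \<subseteq> X - B'" "card A = m"
    using obtain_subset_with_card_n by metis
  have "card ((Y - X) \<union> B') = card (Y - X) + card B'"
    using finB' fin B'(1) by (intro card_Un_disjoint) auto
  then have "card ((Y - X) \<union> B') = n" using B'(2) False by simp
  moreover have "A \<inter> ((Y - X) \<union> B') = {}" using A by auto
  ultimately show ?thesis using A B'(1) by (intro exI[of _ A] exI[of _ "(Y - X) \<union> B'"]) auto
qed

text \<open>The colours are the numbers \<open>0\<close> and \<open>1\<close>, so \<open>1 - c\<close> is the colour opposite to \<open>c\<close>.\<close>

locale two_coloured_complete =
  fixes V :: "'v set" and \<chi> :: "'v set \<Rightarrow> nat"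
  assumes finite_V: "finite V"
    and colours: "\<And>u v. u \<in> V \<Longrightarrow> v \<in> V \<Longrightarrow> u \<noteq> v \<Longrightarrow> \<chi> {u, v} \<in> {0, 1}"
begin

definition nbrs :: "nat \<Rightarrow> 'v \<Rightarrow> 'v set" where
  "nbrs c u = {w \<in> V. w \<noteq> u \<and> \<chi> {u, w} = c}"

text \<open>Apart from the edges of the double star, no colours are prescribed on its vertices, since
  copies need not be induced.\<close>

definition mono_double_star :: "nat \<Rightarrow> nat \<Rightarrow> bool" where
  "mono_double_star m n \<longleftrightarrow> (\<exists>c u v A B. u \<in> V \<and> v \<in> nbrs c u \<and>
     A \<subseteq> nbrs c u - {v} \<and> B \<subseteq> nbrs c v - {u} \<and> A \<inter> B = {} \<and> card A = m \<and> card B = n)"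

lemma nbrs_subset: "nbrs c u \<subseteq> V - {u}"
  by (auto simp: nbrs_def)

lemma finite_nbrs [simp]: "finite (nbrs c u)"
  using nbrs_subset finite_V by (meson finite_Diff finite_subset)

lemma nbrs_sym: "u \<in> V \<Longrightarrow> v \<in> nbrs c u \<Longrightarrow> u \<in> nbrs c v"
  by (auto simp: nbrs_def insert_commute)

lemma nbrs_complement:
  assumes "c \<in> {0, 1}" "u \<in> V"
  shows "nbrs (1 - c) u = V - {u} - nbrs c u"
  using assms colours[of u] by (fastforce simp: nbrs_def)

lemma card_nbrs_complement:
  assumes "c \<in> {0, 1}" "u \<in> V"
  shows "card (nbrs c u) + card (nbrs (1 - c) u) + 1 = card V"
proof -
  have "card (nbrs c u) \<le> card (V - {u})"
    using nbrs_subset finite_V by (intro card_mono) auto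
  moreover have "card (nbrs (1 - c) u) = card (V - {u}) - card (nbrs c u)"
    unfolding nbrs_complement[OF assms] using nbrs_subset by (intro card_Diff_subset) auto
  moreover have "card V = card (V - {u}) + 1"
    using assms(2) finite_V card_Suc_Diff1[of V u] by simp
  ultimately show ?thesis by linarith
qed

text \<open>A vertex outside the closed \<open>c\<close>-neighbourhoods of both ends is a common neighbour in the
  other colour. If there are at most \<open>m\<close> of these, the ends have at least \<open>m + n\<close> further
  \<open>c\<close>-neighbours in total. As \<open>n \<le> m + 1\<close>, at least one end then has \<open>n\<close> of them: two
  sets with fewer than \<open>n\<close> elements cover at most \<open>2n - 2 < m + n\<close>. That end is taken as the centre of
  the larger star.\<close>

lemma common_nbrs_of_edge:
  assumes no: "\<not> mono_double_star m n" and mn: "m \<le> n" "n \<le> m + 1"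
    and N: "card V = 2 * m + n + 2"
    and c: "c \<in> {0, 1}" and u: "u \<in> V" and v: "v \<in> nbrs c u"
    and deg: "m + 1 \<le> card (nbrs c u)" "m + 1 \<le> card (nbrs c v)"
  shows "m + 1 \<le> card (nbrs (1 - c) u \<inter> nbrs (1 - c) v)"
proof (rule ccontr)
  assume few: "\<not> ?thesis"
  define X where "X = nbrs c u - {v}"
  define Y where "Y = nbrs c v - {u}"
  have fin: "finite X" "finite Y" by (auto simp: X_def Y_def)
  have vV: "v \<in> V" "v \<noteq> u" using v by (auto simp: nbrs_def)
  have uv: "u \<in> nbrs c v" using nbrs_sym u v by blast
  have X: "card X + 1 = card (nbrs c u)"
    unfolding X_def using v card_Suc_Diff1[of "nbrs c u" v] by simp
  have Y: "card Y + 1 = card (nbrs c v)"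
    unfolding Y_def using uv card_Suc_Diff1[of "nbrs c v" u] by simp
  let ?D = "nbrs (1 - c) u \<inter> nbrs (1 - c) v"
  have V: "V = {u, v} \<union> (X \<union> Y) \<union> ?D"
    unfolding nbrs_complement[OF c u] nbrs_complement[OF c vV(1)] X_def Y_def
    using nbrs_subset[of c u] nbrs_subset[of c v] u vV by blast
  have "card V \<le> card {u, v} + card (X \<union> Y) + card ?D"
    by (subst V) (meson card_Un_le add_le_mono1 le_trans)
  moreover have "card {u, v} = 2" using vV by simp
  ultimately have big: "m + n \<le> card (X \<union> Y)" using few N by linarith
  have "card X + card Y \<ge> m + n" using big card_Un_le[of X Y] by linarith
  then have "n \<le> card Y \<or> n \<le> card X" using mn by linarith
  then show False
  proof
    assume "n \<le> card Y"
    then obtain A B where "A \<subseteq> X" "B \<subseteq> Y" "A \<inter> B = {}" "card A = m" "card B = n"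
      using disjoint_subsets_of_cards[OF fin, of m n] deg X big by auto
    then show False using no u v unfolding mono_double_star_def X_def Y_def by blast
  next
    assume "n \<le> card X"
    then obtain A B where "A \<subseteq> Y" "B \<subseteq> X" "A \<inter> B = {}" "card A = m" "card B = n"
      using disjoint_subsets_of_cards[OF fin(2,1), of m n] deg Y big by (auto simp: Un_commute)
    then show False using no vV(1) uv unfolding mono_double_star_def X_def Y_def by blast
  qed
qed

text \<open>A vertex whose \<open>c\<close>-degree is small has so many neighbours in the other colour \<open>d\<close> that both
  ways of colouring the edges between them are impossible: they have small \<open>d\<close>-degree, yet a
  \<open>c\<close>-edge between them would give its ends many common \<open>d\<close>-neighbours, and without such an edge
  they form a large \<open>d\<close>-clique.\<close>

lemma min_degree:
  assumes no: "\<not> mono_double_star m n" and mn: "m \<le> n" "n \<le> m + 1"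
    and N: "card V = 2 * m + n + 2"
    and c: "c \<in> {0, 1}" and x: "x \<in> V"
  shows "m + 1 \<le> card (nbrs c x)"
proof (rule ccontr)
  assume small: "\<not> ?thesis"
  define d where "d = 1 - c"
  have d: "d \<in> {0, 1}" "1 - d = c" "1 - c = d" using c by (auto simp: d_def)
  note edge = common_nbrs_of_edge[OF no mn N]
  have large: "m + n + 1 \<le> card (nbrs d x)"
    using card_nbrs_complement[OF c x] small N unfolding d(3) by linarith
  \<comment> \<open>Otherwise the ends of the \<open>d\<close>-edge \<open>xy\<close> have more common \<open>c\<close>-neighbours than \<open>x\<close> has at all.\<close>
  have degd: "card (nbrs d y) \<le> m" if y: "y \<in> nbrs d x" for y
  proof (rule ccontr)
    assume "\<not> ?thesis"
    then have "m + 1 \<le> card (nbrs c x \<inter> nbrs c y)"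
      using edge[OF d(1) x y] large d by simp
    also have "\<dots> \<le> card (nbrs c x)" by (intro card_mono) auto
    finally show False using small by simp
  qed
  have nbV: "y \<in> V" if "y \<in> nbrs d x" for y using that by (auto simp: nbrs_def)
  have degc: "m + 1 \<le> card (nbrs c y)" if y: "y \<in> nbrs d x" for y
    using card_nbrs_complement[OF c nbV[OF y]] degd[OF y] N unfolding d(3) by linarith
  \<comment> \<open>Otherwise the ends of the \<open>c\<close>-edge \<open>yz\<close> have more common \<open>d\<close>-neighbours than \<open>y\<close> has at all.\<close>
  have clique: "z \<in> nbrs d y" if y: "y \<in> nbrs d x" and z: "z \<in> nbrs d x" and "z \<noteq> y" for y z
  proof (rule ccontr)
    assume "\<not> ?thesis"
    then have "z \<in> nbrs c y"
      using nbrs_complement[OF c nbV[OF y]] nbV[OF z] \<open>z \<noteq> y\<close> d by auto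
    then have "m + 1 \<le> card (nbrs d y \<inter> nbrs d z)"
      using edge[OF c nbV[OF y]] degc y z d by simp
    also have "\<dots> \<le> card (nbrs d y)" by (intro card_mono) auto
    finally show False using degd[OF y] by simp
  qed
  have "nbrs d x \<noteq> {}" using large by auto
  then obtain y where y: "y \<in> nbrs d x" by blast
  have "nbrs d x - {y} \<subseteq> nbrs d y" using clique y by auto
  then have "card (nbrs d x - {y}) \<le> card (nbrs d y)" by (intro card_mono) auto
  \<comment> \<open>Counting \<open>x\<close> as well makes up for the loss of \<open>y\<close>.\<close>
  moreover have "x \<in> nbrs d y" "x \<notin> nbrs d x" using nbrs_sym[OF x y] by (auto simp: nbrs_def)
  ultimately have "card (insert x (nbrs d x - {y})) \<le> card (nbrs d y)"
    using \<open>nbrs d x - {y} \<subseteq> nbrs d y\<close> by (intro card_mono) auto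
  then have "card (nbrs d x) \<le> card (nbrs d y)"
    using y \<open>x \<notin> nbrs d x\<close> card_Suc_Diff1[of "nbrs d x" y] by simp
  then show False using large degd[OF y] by linarith
qed

section \<open>Counting triangles with two colours\<close>

text \<open>The apexes \<open>w\<close> of the triangles on \<open>uv\<close> in which \<open>uv\<close> is the edge of the odd colour.\<close>

definition opp_nbrs :: "'v \<Rightarrow> 'v \<Rightarrow> 'v set" where
  "opp_nbrs u v = nbrs (1 - \<chi> {u, v}) u \<inter> nbrs (1 - \<chi> {u, v}) v"

text \<open>Double counting over ordered triples of distinct vertices. The triples \<open>(u, v, w)\<close> in which
  \<open>uv\<close> is the edge of the odd colour form a set whose three cyclic rotations are pairwise
  disjoint, because a triangle has at most one such edge. So this set makes up at most a third of
  all the triples.\<close>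

lemma opp_nbrs_count:
  assumes k: "\<And>u v. u \<in> V \<Longrightarrow> v \<in> V \<Longrightarrow> u \<noteq> v \<Longrightarrow> k \<le> card (opp_nbrs u v)"
    and N: "2 \<le> card V"
  shows "3 * k \<le> card V - 2"
proof -
  define T where "T = (SIGMA u:V. SIGMA v:V - {u}. V - {u, v})"
  define P where "P = (SIGMA u:V. SIGMA v:V - {u}. opp_nbrs u v)"
  define rot where "rot = (\<lambda>(u::'v, v::'v, w::'v). (v, w, u))"
  have finT: "finite T" unfolding T_def using finite_V by auto
  have PT: "P \<subseteq> T" unfolding P_def T_def opp_nbrs_def nbrs_def by auto
  have finP: "finite P" using PT finT finite_subset by blast
  have injrot: "inj rot" by (auto simp: inj_def rot_def)
  have rotT: "rot ` T \<subseteq> T" unfolding T_def rot_def by auto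
  have P_iff: "(u, v, w) \<in> P \<longleftrightarrow> {u, v, w} \<subseteq> V \<and> distinct [u, v, w] \<and>
      \<chi> {u, w} = 1 - \<chi> {u, v} \<and> \<chi> {v, w} = 1 - \<chi> {u, v}" for u v w
    unfolding P_def opp_nbrs_def nbrs_def by auto
  have d1: "P \<inter> rot ` P = {}"
  proof -
    have False if "(u, v, w) \<in> P" "(v, w, u) \<in> P" for u v w
      using that colours[of u v] unfolding P_iff by (auto simp: insert_commute)
    then show ?thesis by (force simp: rot_def)
  qed
  have d2: "P \<inter> rot ` rot ` P = {}"
  proof -
    have False if "(u, v, w) \<in> P" "(w, u, v) \<in> P" for u v w
      using that colours[of u v] unfolding P_iff by (auto simp: insert_commute)
    then show ?thesis by (force simp: rot_def)
  qed
  have d3: "rot ` P \<inter> rot ` rot ` P = {}"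
    using d1 injrot by (metis image_Int image_empty)
  have "3 * card P = card (P \<union> rot ` P \<union> rot ` rot ` P)"
  proof -
    have "card (rot ` P) = card P" "card (rot ` rot ` P) = card P"
      using injrot by (metis card_image inj_on_subset subset_UNIV)+
    moreover have "card (P \<union> rot ` P \<union> rot ` rot ` P) = card P + card (rot ` P) + card (rot ` rot ` P)"
      using finP d1 d2 d3 by (subst card_Un_disjoint; (simp add: Int_Un_distrib2 card_Un_disjoint)?)
    ultimately show ?thesis by simp
  qed
  also have "\<dots> \<le> card T"
    using PT rotT by (intro card_mono finT) blast
  finally have "3 * card P \<le> card T" .
  moreover have "card T = card V * ((card V - 1) * (card V - 2))"
  proof -
    have "card (V - {u, v}) = card V - 2" if "u \<in> V" "v \<in> V - {u}" for u v
      using that by (subst card_Diff_subset) auto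
    then show ?thesis unfolding T_def using finite_V by (simp add: card_SigmaI)
  qed
  moreover have "card V * ((card V - 1) * k) \<le> card P"
  proof -
    have "card V * ((card V - 1) * k) = (\<Sum>u\<in>V. \<Sum>v\<in>V - {u}. k)"
      using finite_V by simp
    also have "\<dots> \<le> (\<Sum>u\<in>V. \<Sum>v\<in>V - {u}. card (opp_nbrs u v))"
      using k by (intro sum_mono) auto
    also have "\<dots> = card P"
      unfolding P_def using finite_V by (simp add: card_SigmaI opp_nbrs_def)
    finally show ?thesis .
  qed
  ultimately have "3 * (card V * ((card V - 1) * k)) \<le> card V * ((card V - 1) * (card V - 2))"
    by linarith
  then have "(card V * (card V - 1)) * (3 * k) \<le> (card V * (card V - 1)) * (card V - 2)"
    by (simp only: mult_ac)
  moreover have "0 < card V * (card V - 1)" using N by simp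
  ultimately show ?thesis by (metis mult_le_cancel1)
qed

text \<open>Without such a star, \<open>k = m + 1\<close> is admissible in the triangle count, whose bound
  reads \<open>3m + 3 \<le> 2m + n\<close>.\<close>

theorem mono_double_star_exists:
  assumes mn: "m \<le> n" "n \<le> m + 1" and N: "card V = 2 * m + n + 2"
  shows "mono_double_star m n"
proof (rule ccontr)
  assume no: "\<not> ?thesis"
  have "m + 1 \<le> card (opp_nbrs u v)" if "u \<in> V" "v \<in> V" "u \<noteq> v" for u v
    unfolding opp_nbrs_def
    using that colours[OF that] min_degree[OF no mn N]
    by (intro common_nbrs_of_edge[OF no mn N]) (auto simp: nbrs_def)
  then have "3 * (m + 1) \<le> card V - 2" using N by (intro opp_nbrs_count) auto
  then show False using N mn by simp
qed

end

section \<open>Embedding a bistar\<close>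

text \<open>Since a leaf has only one neighbour, an edge between two leaves would be a whole component;
  connectedness and the presence of the centres exclude it. So every edge meets a centre,
  and every leaf hangs on exactly one of the centres.\<close>

lemma bistar_structure:
  assumes "bistar m n G"
  obtains a b A B where
    "finite (verts G)"
    "verts G = {a, b} \<union> A \<union> B" "a \<noteq> b" "{a, b} \<inter> (A \<union> B) = {}" "A \<inter> B = {}"
    "card A = m" "card B = n"
    "\<And>e. e \<in> edges G \<Longrightarrow> e = {a, b} \<or> (\<exists>x\<in>A. e = {a, x}) \<or> (\<exists>x\<in>B. e = {b, x})"
proof -
  obtain a b where tree: "tree G" and ab: "a \<noteq> b"
    and nl: "{v \<in> verts G. \<not> leaf G v} = {a, b}" and abE: "{a, b} \<in> edges G"
    and cA: "card {v \<in> neighbors G a. leaf G v} = m"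
    and cB: "card {v \<in> neighbors G b. leaf G v} = n"
    using assms unfolding bistar_def by blast
  define A where "A = {v \<in> neighbors G a. leaf G v}"
  define B where "B = {v \<in> neighbors G b. leaf G v}"
  have fin: "finite (verts G)" and E: "edges G \<subseteq> [verts G]\<^bsup>2\<^esup>"
    and con: "connected_graph G"
    using tree by (auto simp: tree_def fin_simple_graph_def)
  have edgeD: "x \<noteq> y \<and> x \<in> verts G \<and> y \<in> verts G" if "{x, y} \<in> edges G" for x y
  proof -
    have "{x, y} \<in> [verts G]\<^bsup>2\<^esup>" using that E by blast
    then show ?thesis by (cases "x = y") (auto simp: nsets_def)
  qed
  have abV: "a \<in> verts G" "b \<in> verts G" "\<not> leaf G a" "\<not> leaf G b" using nl by auto
  have leaf_unique: "y = z" if "leaf G x" "{y, x} \<in> edges G" "{z, x} \<in> edges G" for x y z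
  proof -
    have "card (neighbors G x) = 1" using that(1) by (simp add: leaf_def degree_def)
    moreover have "y \<in> neighbors G x" "z \<in> neighbors G x"
      using that edgeD by (auto simp: neighbors_def)
    ultimately show ?thesis by (metis card_1_singletonE singletonD)
  qed
  have no_leaf_edge: False if x: "leaf G x" and y: "leaf G y" and xy: "{x, y} \<in> edges G" for x y
  proof -
    \<comment> \<open>\<open>{x, y}\<close> is closed under adjacency, so the centre \<open>a\<close> would be out of reach.\<close>
    have "z \<in> {x, y}" if "(x, z) \<in> {(p, q). {p, q} \<in> edges G}\<^sup>*" for z
      using that
    proof induction
      case base
      then show ?case by simp
    next
      case (step p q)
      then show ?case
        using leaf_unique[OF x, of y q] leaf_unique[OF y, of x q] xy by (auto simp: insert_commute)
    qed
    moreover have "(x, a) \<in> {(p, q). {p, q} \<in> edges G}\<^sup>*"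
      using con abV edgeD[OF xy] unfolding connected_graph_def by blast
    ultimately show False using abV x y by blast
  qed
  have edges_form: "e = {a, b} \<or> (\<exists>x\<in>A. e = {a, x}) \<or> (\<exists>x\<in>B. e = {b, x})"
    if e: "e \<in> edges G" for e
  proof -
    have "e \<in> [verts G]\<^bsup>2\<^esup>" using e E by blast
    then obtain x y where xy: "e = {x, y}" by (auto simp: nsets_def card_2_iff)
    have V: "x \<noteq> y" "x \<in> verts G" "y \<in> verts G" using edgeD e xy by auto
    have centre: "p \<in> {a, b} \<or> leaf G p" if "p \<in> verts G" for p using nl that by blast
    have AB: "(p = a \<and> q \<in> A) \<or> (p = b \<and> q \<in> B)"
      if "p \<in> {a, b}" "leaf G q" "{p, q} \<in> edges G" for p q
      using that edgeD[OF that(3)] by (auto simp: A_def B_def neighbors_def insert_commute)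
    show ?thesis
    proof (cases "leaf G x")
      case True
      then have "\<not> leaf G y" using no_leaf_edge e xy by blast
      then show ?thesis using AB[of y x] centre[OF V(3)] True e xy by (auto simp: insert_commute)
    next
      case x: False
      then show ?thesis using AB[of x y] centre[OF V(3)] centre[OF V(2)] V e xy by auto
    qed
  qed
  have "verts G \<subseteq> {a, b} \<union> A \<union> B"
  proof
    fix x assume x: "x \<in> verts G"
    show "x \<in> {a, b} \<union> A \<union> B"
    proof (cases "leaf G x")
      case True
      then have "neighbors G x \<noteq> {}" by (auto simp: leaf_def degree_def)
      then obtain y where "{y, x} \<in> edges G" by (auto simp: neighbors_def)
      from edges_form[OF this] show ?thesis by (auto simp: doubleton_eq_iff)
    qed (use nl x in blast)
  qed
  moreover have "A \<subseteq> verts G" "B \<subseteq> verts G" by (auto simp: A_def B_def neighbors_def)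
  ultimately have "verts G = {a, b} \<union> A \<union> B" using abV by auto
  moreover have "{a, b} \<inter> (A \<union> B) = {}" using abV by (auto simp: A_def B_def)
  moreover have "A \<inter> B = {}"
    using leaf_unique[of _ a b] ab by (auto simp: A_def B_def neighbors_def insert_commute)
  ultimately show thesis
    using that[of a b A B] fin ab cA cB edges_form by (simp add: A_def B_def)
qed

lemma bistar_embeds:
  assumes G: "bistar m n G" and "two_coloured_complete V \<chi>"
    and star: "two_coloured_complete.mono_double_star V \<chi> m n"
  shows "\<exists>f c. inj_on f (verts G) \<and> f ` verts G \<subseteq> V \<and> (\<forall>e\<in>edges G. \<chi> (f ` e) = c)"
proof -
  interpret two_coloured_complete V \<chi> by fact
  obtain a b A B where fin: "finite (verts G)" and
    V: "verts G = {a, b} \<union> A \<union> B" and ab: "a \<noteq> b" and dis: "{a, b} \<inter> (A \<union> B) = {}" "A \<inter> B = {}"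
    and card: "card A = m" "card B = n"
    and E: "\<And>e. e \<in> edges G \<Longrightarrow> e = {a, b} \<or> (\<exists>x\<in>A. e = {a, x}) \<or> (\<exists>x\<in>B. e = {b, x})"
    by (rule bistar_structure[OF G]) (rule that)
  obtain c u v A' B' where u: "u \<in> V" and v: "v \<in> nbrs c u"
    and A': "A' \<subseteq> nbrs c u - {v}" and B': "B' \<subseteq> nbrs c v - {u}" and dis': "A' \<inter> B' = {}"
    and card': "card A' = m" "card B' = n"
    using star unfolding mono_double_star_def by blast
  have finAB: "finite A" "finite B" "finite A'" "finite B'"
    using fin V A' B' by (auto intro: finite_subset[OF _ finite_nbrs])
  obtain g where g: "bij_betw g A A'" using finite_same_card_bij[OF finAB(1,3)] card card' by auto
  obtain h where h: "bij_betw h B B'" using finite_same_card_bij[OF finAB(2,4)] card card' by auto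
  define f where "f x = (if x = a then u else if x = b then v else if x \<in> A then g x else h x)" for x
  have fab: "f a = u" "f b = v" using ab by (auto simp: f_def)
  have fA: "f x = g x" if "x \<in> A" for x using that dis by (auto simp: f_def)
  have fB: "f x = h x" if "x \<in> B" for x using that dis by (auto simp: f_def)
  have gA: "g x \<in> A'" if "x \<in> A" for x using g that by (auto simp: bij_betw_def)
  have hB: "h x \<in> B'" if "x \<in> B" for x using h that by (auto simp: bij_betw_def)
  have fA': "f x \<in> nbrs c u" if "x \<in> A" for x using fA gA that A' by auto
  have fB': "f x \<in> nbrs c v" if "x \<in> B" for x using fB hB that B' by auto
  have uv: "u \<noteq> v" "u \<notin> A'" "u \<notin> B'" "v \<notin> A'" "v \<notin> B'"
    using v A' B' by (auto simp: nbrs_def)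
  have "inj_on f A" "inj_on f B"
    using g h fA fB by (auto simp: bij_betw_def inj_on_def)
  moreover have "f ` A \<subseteq> A'" "f ` B \<subseteq> B'" using fA fB gA hB by auto
  ultimately have "inj_on f (A \<union> B)" "f ` (A \<union> B) \<inter> {u, v} = {}"
    using dis' uv by (auto simp: inj_on_Un)
  moreover have "inj_on f {a, b}" "f ` {a, b} = {u, v}" using fab uv by auto
  ultimately have "inj_on f ({a, b} \<union> (A \<union> B))" by (subst inj_on_Un) blast
  then have "inj_on f (verts G)" unfolding V by (simp add: Un_assoc)
  moreover have "f ` verts G \<subseteq> V"
    unfolding V using fab fA' fB' u v by (auto simp: nbrs_def)
  moreover have "\<forall>e\<in>edges G. \<chi> (f ` e) = c"
  proof
    fix e assume "e \<in> edges G"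
    from E[OF this] show "\<chi> (f ` e) = c"
      using fab fA' fB' v by (auto simp: nbrs_def)
  qed
  ultimately show ?thesis by blast
qed

text \<open>The copy is the image of \<open>G\<close>, not the subgraph induced on it, so that edges map
  onto edges and injectivity alone makes \<open>f\<close> an isomorphism.\<close>

lemma embedding_gives_mono_copy:
  assumes G: "fin_simple_graph G" and inj: "inj_on f (verts G)" and range: "f ` verts G \<subseteq> {..<r}"
    and mono: "\<forall>e\<in>edges G. \<chi> (f ` e) = c"
  shows "\<exists>H. subgraph H (complete_graph r) \<and> mono_edges \<chi> H \<and> graph_isomorphic G H"
proof -
  define H where "H = (f ` verts G, (`) f ` edges G)"
  have E: "edges G \<subseteq> [verts G]\<^bsup>2\<^esup>" and fin: "finite (verts G)"
    using G by (auto simp: fin_simple_graph_def)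
  have EH: "edges H \<subseteq> [verts H]\<^bsup>2\<^esup>"
  proof
    fix e' assume "e' \<in> edges H"
    then obtain e where e: "e \<in> edges G" "e' = f ` e" by (auto simp: H_def)
    then have "e \<subseteq> verts G" "finite e" "card e = 2" using E by (auto simp: nsets_def)
    moreover have "card (f ` e) = card e"
      using inj \<open>e \<subseteq> verts G\<close> by (meson card_image inj_on_subset)
    ultimately show "e' \<in> [verts H]\<^bsup>2\<^esup>" by (auto simp: e H_def nsets_def)
  qed
  have VH: "verts H \<subseteq> {..<r}" using range by (simp add: H_def)
  have "subgraph H (complete_graph r)"
    using EH VH fin nsets_mono[OF VH, of 2]
    by (auto simp: subgraph_def fin_simple_graph_def complete_graph_def H_def)
  moreover have "mono_edges \<chi> H" using mono by (auto simp: mono_edges_def H_def)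
  moreover have "graph_isomorphic G H"
    unfolding graph_isomorphic_def
  proof (intro exI[of _ f] conjI ballI)
    show "bij_betw f (verts G) (verts H)" using inj by (simp add: bij_betw_def H_def)
    fix u v assume uv: "u \<in> verts G" "v \<in> verts G"
    show "{u, v} \<in> edges G \<longleftrightarrow> {f u, f v} \<in> edges H"
    proof
      assume "{u, v} \<in> edges G"
      then have "f ` {u, v} \<in> edges H" unfolding H_def snd_conv by (rule imageI)
      then show "{f u, f v} \<in> edges H" by simp
    next
      assume "{f u, f v} \<in> edges H"
      then obtain e where e: "e \<in> edges G" "f ` {u, v} = f ` e" by (auto simp: H_def)
      moreover have "e \<subseteq> verts G" using e E by (auto simp: nsets_def)
      ultimately have "{u, v} = e" using inj uv by (metis bot_least inj_on_image_eq_iff insert_subset)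
      then show "{u, v} \<in> edges G" using e by simp
    qed
  qed
  ultimately show ?thesis by blast
qed

theorem proposition3p5:
  fixes m n :: nat and G :: "'a graph"
  assumes "m \<ge> 2"
    and "n \<in> {m, m + 1}"
    and "bistar m n G"
  shows "ramsey_number G \<le> 2 * m + n + 2"
  unfolding ramsey_number_def
  \<comment> \<open>The Ramsey number is the least order that forces a copy, so it suffices that this order does.\<close>
proof (rule Least_le, rule ballI)
  let ?r = "2 * m + n + 2"
  fix \<chi> assume \<chi>: "\<chi> \<in> two_colorings (complete_graph ?r)"
  interpret two_coloured_complete "{..<?r}" \<chi>
  proof
    fix u v assume "u \<in> {..<?r}" "v \<in> {..<?r}" "u \<noteq> v"
    then have "{u, v} \<in> [{..<?r}]\<^bsup>2\<^esup>" by (auto simp: nsets_def)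
    then show "\<chi> {u, v} \<in> {0, 1}"
      using \<chi> unfolding two_colorings_def complete_graph_def by (auto simp: Pi_iff)
  qed simp
  have "mono_double_star m n"
    using assms(2) by (intro mono_double_star_exists) auto
  then obtain f c where "inj_on f (verts G)" "f ` verts G \<subseteq> {..<?r}" "\<forall>e\<in>edges G. \<chi> (f ` e) = c"
    using bistar_embeds[OF assms(3) two_coloured_complete_axioms] by blast
  moreover have "fin_simple_graph G" using assms(3) by (auto simp: bistar_def tree_def)
  ultimately show "\<exists>H. subgraph H (complete_graph ?r) \<and> mono_edges \<chi> H \<and> graph_isomorphic G H"
    by (rule embedding_gives_mono_copy[rotated])
qed

end
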